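(* Let $n\ge 1$, let $N$ be an $n$-dimensional $C^\infty$ manifold without boundary, let $(f,\nu): N\to\mathbb{R}^{n+1}\times S^n$ be a frontal, and let $P\in\mathbb{R}^{n+1}$ be a point such that $P\in\mathcal{NS}_f$, i.e. $(f(x)-P)\cdot\nu(x)\neq 0$ for every $x\in N$. Let $\widetilde f: N\to\mathbb{R}^{n+1}$ be the mapping defined by $$\widetilde f(x)=f(x)-\frac{\|f(x)-P\|^2}{2(f(x)-P)\cdot\nu(x)}\,\nu(x).$$ Then the following four assertions hold: (1) The mapping $\widetilde f$ is a frontal with Gauss mapping $\widetilde\nu(x)=\frac{f(x)-P}{\|f(x)-P\|}$. (2) The mapping $\widetilde f$ is the unique anti-orthotomic of $f$ relative to $P$. (3) The point $P$ belongs to $\mathcal{NS}_{\widetilde f}$, i.e. $(\widetilde f(x)-P)\cdot\widetilde\nu(x)\neq 0$ for every $x\in N$. (4) The equality $\|\widetilde f(x)-P\|=\|\widetilde f(x)-f(x)\|$ holds for every $x\in N$.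
   Context: All mappings are of class $C^\infty$. $S^n\subset\mathbb{R}^{n+1}$ is the unit sphere, $\cdot$ is the Euclidean scalar product, and $T_{y}\mathbb{R}^{n+1}$ is identified with $\mathbb{R}^{n+1}$. A mapping $f:N\to\mathbb{R}^{n+1}$ is a frontal if there is a mapping $\nu:N\to S^n$ (called its Gauss mapping) with $df_x(\mathbf v)\cdot\nu(x)=0$ for all $x\in N$, $\mathbf v\in T_xN$; the pair $(f,\nu)$ is also called a frontal. For a frontal $(f,\nu)$, the no-silhouette is $\mathcal{NS}_f=\{P\in\mathbb{R}^{n+1} : (f(x)-P)\cdot\nu(x)\neq 0 \text{ for all } x\in N\}$. Given a $C^\infty$ mapping $f:N\to\mathbb{R}^{n+1}$ and $P\in\mathbb{R}^{n+1}$, a frontal $\widetilde f:N\to\mathbb{R}^{n+1}$ with Gauss mapping $\widetilde\nu:N\to S^n$ is called the anti-orthotomic of $f$ relative to $P$ if $f(x)=2\left((\widetilde f(x)-P)\cdot\widetilde\nu(x)\right)\widetilde\nu(x)+P$ for all $x\in N$.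
   Formalization: Uniqueness in (2) fails as stated (e.g. f constant); instead: every anti-orthotomic g of f equals f̃ on the closure of the points where df is injective (so everywhere if these are dense), and at each x where g(x)−f(x) is a multiple of ν(x). *)

theory Defs
  imports "HOL-Analysis.Analysis"
begin

(* Ck_on k F S is meant for open S.  Continuity of all iterated directional derivatives up to
   order k is equivalent to F being of class C^k on S. *)
fun Ck_on :: "nat \<Rightarrow> ('v::euclidean_space \<Rightarrow> 'w::real_normed_vector) \<Rightarrow> 'v set \<Rightarrow> bool" where
  "Ck_on 0 F S \<longleftrightarrow> continuous_on S F"
| "Ck_on (Suc k) F S \<longleftrightarrow>
     (\<forall>y\<in>S. F differentiable (at y)) \<and>
     (\<forall>v. Ck_on k (\<lambda>y. frechet_derivative F (at y) v) S)"

definition smooth_on :: "('v::euclidean_space \<Rightarrow> 'w::real_normed_vector) \<Rightarrow> 'v set \<Rightarrow> bool" where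
  "smooth_on F S \<longleftrightarrow> (\<forall>k. Ck_on k F S)"

type_synonym ('a, 'n) chart = "'a set \<times> ('a \<Rightarrow> real^'n)"

(* The expression of f in the chart c = (U, phi); it is meaningful on phi ` U only. *)
definition in_chart :: "('a, 'n::finite) chart \<Rightarrow> ('a \<Rightarrow> 'w) \<Rightarrow> real^'n \<Rightarrow> 'w" where
  "in_chart c f = f \<circ> inv_into (fst c) (snd c)"

(* The atlas need not be maximal. *)
definition smooth_manifold :: "'a topology \<Rightarrow> ('a, 'n::finite) chart set \<Rightarrow> bool" where
  "smooth_manifold X A \<longleftrightarrow>
     Hausdorff_space X \<and> second_countable X \<and>
     topspace X = (\<Union>(U, \<phi>)\<in>A. U) \<and>
     (\<forall>(U, \<phi>)\<in>A. openin X U \<and> open (\<phi> ` U) \<and>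
        homeomorphic_map (subtopology X U) (top_of_set (\<phi> ` U)) \<phi>) \<and>
     (\<forall>(U, \<phi>)\<in>A. \<forall>(V, \<psi>)\<in>A. smooth_on (in_chart (U, \<phi>) \<psi>) (\<phi> ` (U \<inter> V)))"

definition smooth_map ::
  "('a, 'n::finite) chart set \<Rightarrow> ('a \<Rightarrow> 'w::real_normed_vector) \<Rightarrow> bool" where
  "smooth_map A f \<longleftrightarrow> (\<forall>(U, \<phi>)\<in>A. smooth_on (in_chart (U, \<phi>) f) (\<phi> ` U))"

(* df_x, where tangent vectors at x are represented by their coordinates in the chart c. *)
definition chart_differential ::
  "('a, 'n::finite) chart \<Rightarrow> ('a \<Rightarrow> 'w::real_normed_vector) \<Rightarrow> 'a \<Rightarrow> real^'n \<Rightarrow> 'w" where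
  "chart_differential c f x = frechet_derivative (in_chart c f) (at (snd c x))"

definition frontal ::
  "'a topology \<Rightarrow> ('a, 'n::finite) chart set \<Rightarrow> ('a \<Rightarrow> real^'m) \<Rightarrow> ('a \<Rightarrow> real^'m) \<Rightarrow> bool" where
  "frontal X A f \<nu> \<longleftrightarrow>
     smooth_map A f \<and> smooth_map A \<nu> \<and> (\<forall>x\<in>topspace X. \<nu> x \<in> sphere 0 1) \<and>
     (\<forall>x\<in>topspace X. \<forall>c\<in>A. x \<in> fst c \<longrightarrow> (\<forall>v. chart_differential c f x v \<bullet> \<nu> x = 0))"

definition no_silhouette ::
  "'a topology \<Rightarrow> ('a \<Rightarrow> real^'m) \<Rightarrow> ('a \<Rightarrow> real^'m) \<Rightarrow> (real^'m) set" where
  "no_silhouette X f \<nu> = {P. \<forall>x\<in>topspace X. (f x - P) \<bullet> \<nu> x \<noteq> 0}"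

definition anti_orthotomic ::
  "'a topology \<Rightarrow> ('a, 'n::finite) chart set \<Rightarrow> ('a \<Rightarrow> real^'m) \<Rightarrow> real^'m \<Rightarrow>
   ('a \<Rightarrow> real^'m) \<Rightarrow> ('a \<Rightarrow> real^'m) \<Rightarrow> bool" where
  "anti_orthotomic X A f P g \<mu> \<longleftrightarrow>
     frontal X A g \<mu> \<and>
     (\<forall>x\<in>topspace X. f x = (2 * ((g x - P) \<bullet> \<mu> x)) *\<^sub>R \<mu> x + P)"

(* In anti_orthotomic the Gauss mapping of f does not occur, and f alone need not determine g: if
   f = Q is constant, then every smooth g with values in the hyperplane bisecting the segment PQ
   orthogonally is an anti-orthotomic of f, with constant Gauss mapping.  Thus "the" anti-orthotomic
   of a frontal (f, nu) is unique in two senses: among all anti-orthotomics of f, on the closure of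
   the regular points of f (everywhere if these are dense); and at all points of N among those
   compatible with nu, i.e. with g x on the normal line f x + span {nu x}. *)
definition regular_points ::
  "'a topology \<Rightarrow> ('a, 'n::finite) chart set \<Rightarrow> ('a \<Rightarrow> 'w::real_normed_vector) \<Rightarrow> 'a set" where
  "regular_points X A f =
     {x \<in> topspace X. \<exists>c\<in>A. x \<in> fst c \<and> inj (chart_differential c f x)}"

end

theory Submission
  imports Defs
begin

text \<open>
  Both the anti-orthotomic \<open>g\<close> and its Gauss map \<open>\<mu>\<close> are governed by the single equation
  \<open>\<parallel>f - P\<parallel>\<^sup>2 = 2 (f - P) \<bullet> (g - P)\<close>, which says that \<open>g\<close> lies on the hyperplane bisecting the
  segment from \<open>P\<close> to \<open>f\<close>. Differentiating it gives \<open>df \<bullet> (f - g) = (f - P) \<bullet> dg\<close>, so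
  \<open>dg\<close> is orthogonal to \<open>f - P\<close> precisely when \<open>g - f\<close> is normal to \<open>f\<close>. The normal line of
  \<open>f\<close> meets the bisecting hyperplane in one point, since \<open>(f - P) \<bullet> \<nu> \<noteq> 0\<close>. At a regular point
  of \<open>f\<close> the vectors orthogonal to the image of \<open>df\<close> are the multiples of \<open>\<nu>\<close>, which gives
  uniqueness there, and continuity gives it on the closure of the regular points.
\<close>

subsection \<open>Calculus of smooth maps\<close>

text \<open>On an open set, equal functions have equal germs and hence equal derivatives, so the
  induction can pass to the directional derivatives.\<close>

lemma Ck_on_cong:
  assumes "open S" "\<And>y. y \<in> S \<Longrightarrow> F y = G y" "Ck_on k F S"
  shows "Ck_on k G S"
  using assms(2,3)
proof (induction k arbitrary: F G)
  case 0
  then show ?case by (simp cong: continuous_on_cong)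
next
  case (Suc k)
  have d: "(G has_derivative frechet_derivative F (at y)) (at y)" if "y \<in> S" for y
  proof (rule has_derivative_transform_within_open[OF _ assms(1) that])
    show "(F has_derivative frechet_derivative F (at y)) (at y)"
      using Suc.prems(2) that by (simp add: frechet_derivative_works)
  qed (use Suc.prems(1) in auto)
  have "Ck_on k (\<lambda>y. frechet_derivative G (at y) v) S" for v
  proof (rule Suc.IH)
    show "Ck_on k (\<lambda>y. frechet_derivative F (at y) v) S"
      using Suc.prems(2) by simp
  qed (use frechet_derivative_at[OF d] in auto)
  then show ?case
    using d by (auto simp: differentiable_def)
qed

text \<open>Lets the closure properties below work with an explicit derivative formula; uniqueness
  of the derivative identifies it with \<open>frechet_derivative\<close>.\<close>

lemma Ck_on_Suc_has_derivative:
  assumes "open S" "\<And>y. y \<in> S \<Longrightarrow> (F has_derivative F' y) (at y)"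
    and "\<And>v. Ck_on k (\<lambda>y. F' y v) S"
  shows "Ck_on (Suc k) F S"
proof -
  have "Ck_on k (\<lambda>y. frechet_derivative F (at y) v) S" for v
    by (rule Ck_on_cong[OF assms(1) _ assms(3)[of v]])
      (use frechet_derivative_at[OF assms(2)] in auto)
  then show ?thesis
    using assms(2) by (auto simp: differentiable_def)
qed

lemma Ck_on_Suc_D:
  assumes "Ck_on (Suc k) F S"
  shows "\<And>y. y \<in> S \<Longrightarrow> (F has_derivative frechet_derivative F (at y)) (at y)"
    and "\<And>v. Ck_on k (\<lambda>y. frechet_derivative F (at y) v) S"
  using assms by (auto simp: frechet_derivative_works)

lemma Ck_on_Suc_imp: "Ck_on (Suc k) F S \<Longrightarrow> Ck_on k F S"
proof (induction k arbitrary: F)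
  case 0
  then show ?case
    by (auto intro!: continuous_at_imp_continuous_on differentiable_imp_continuous_within)
next
  case (Suc k)
  then show ?case by (metis Ck_on.simps(2))
qed

lemma Ck_on_const: "Ck_on k (\<lambda>_. c) S"
  by (induction k arbitrary: c) auto

lemma Ck_on_diff:
  assumes "open S"
  shows "Ck_on k F S \<Longrightarrow> Ck_on k G S \<Longrightarrow> Ck_on k (\<lambda>y. F y - G y) S"
proof (induction k arbitrary: F G)
  case 0
  then show ?case by (auto intro: continuous_intros)
next
  case (Suc k)
  show ?case
    by (rule Ck_on_Suc_has_derivative[OF assms has_derivative_diff])
      (auto intro!: Suc.IH Ck_on_Suc_D[OF Suc.prems(1)] Ck_on_Suc_D[OF Suc.prems(2)]
        simp del: Ck_on.simps)
qed

lemma Ck_on_add: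
  assumes "open S"
  shows "Ck_on k F S \<Longrightarrow> Ck_on k G S \<Longrightarrow> Ck_on k (\<lambda>y. F y + G y) S"
proof (induction k arbitrary: F G)
  case 0
  then show ?case by (auto intro: continuous_intros)
next
  case (Suc k)
  show ?case
    by (rule Ck_on_Suc_has_derivative[OF assms has_derivative_add])
      (auto intro!: Suc.IH Ck_on_Suc_D[OF Suc.prems(1)] Ck_on_Suc_D[OF Suc.prems(2)]
        simp del: Ck_on.simps)
qed

text \<open>The product rule leaves one factor undifferentiated in each summand;
  \<open>Ck_on_Suc_imp\<close> lowers its order so that the induction hypothesis applies.\<close>

lemma (in bounded_bilinear) Ck_on:
  assumes "open S"
  shows "Ck_on k F S \<Longrightarrow> Ck_on k G S \<Longrightarrow> Ck_on k (\<lambda>y. prod (F y) (G y)) S"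
proof (induction k arbitrary: F G)
  case 0
  then show ?case by (auto intro: continuous_on)
next
  case (Suc k)
  show ?case
    by (rule Ck_on_Suc_has_derivative[OF assms FDERIV])
      (auto intro!: Suc.IH Ck_on_add[OF assms] Ck_on_Suc_D[OF Suc.prems(1)]
        Ck_on_Suc_D[OF Suc.prems(2)] Ck_on_Suc_imp[OF Suc.prems(1)] Ck_on_Suc_imp[OF Suc.prems(2)]
        simp del: Ck_on.simps)
qed

lemmas Ck_on_mult = bounded_bilinear.Ck_on[OF bounded_bilinear_mult]
  and Ck_on_inner = bounded_bilinear.Ck_on[OF bounded_bilinear_inner]
  and Ck_on_scaleR = bounded_bilinear.Ck_on[OF bounded_bilinear_scaleR]

lemma Ck_on_inverse:
  fixes F :: "'v::euclidean_space \<Rightarrow> real"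
  assumes "open S" "\<And>y. y \<in> S \<Longrightarrow> F y \<noteq> 0"
  shows "Ck_on k F S \<Longrightarrow> Ck_on k (\<lambda>y. inverse (F y)) S"
proof (induction k)
  case 0
  then show ?case using assms by (auto intro: continuous_intros)
next
  case (Suc k)
  have inv: "Ck_on k (\<lambda>y. inverse (F y)) S"
    by (rule Suc.IH[OF Ck_on_Suc_imp[OF Suc.prems]])
  show ?case
  proof (rule Ck_on_Suc_has_derivative[OF assms(1)])
    \<comment> \<open>The derivative is a product containing \<open>inverse (F y)\<close> itself,
      which is of order \<open>k\<close> by induction. Writing \<open>0 - ...\<close> for the sign
      brings it under \<open>Ck_on_diff\<close> and \<open>Ck_on_const\<close>.\<close>
    show "((\<lambda>y. inverse (F y)) has_derivative
        (\<lambda>v. (0 - inverse (F y)) * frechet_derivative F (at y) v * inverse (F y))) (at y)"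
      if "y \<in> S" for y
      using Deriv.has_derivative_inverse[OF assms(2)[OF that] Ck_on_Suc_D(1)[OF Suc.prems that]]
      by simp
  qed (intro Ck_on_mult Ck_on_diff Ck_on_const assms inv Ck_on_Suc_D(2)[OF Suc.prems])
qed

lemma Ck_on_sqrt:
  assumes "open S" "\<And>y. y \<in> S \<Longrightarrow> F y > 0"
  shows "Ck_on k F S \<Longrightarrow> Ck_on k (\<lambda>y. sqrt (F y)) S"
proof (induction k)
  case 0
  then show ?case by (auto intro: continuous_intros)
next
  case (Suc k)
  have "Ck_on k (\<lambda>y. sqrt (F y)) S"
    by (rule Suc.IH[OF Ck_on_Suc_imp[OF Suc.prems]])
  moreover have "sqrt (F y) \<noteq> 0" if "y \<in> S" for y
    using assms(2)[OF that] by simp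
  ultimately have inv: "Ck_on k (\<lambda>y. inverse (sqrt (F y))) S"
    by (intro Ck_on_inverse assms(1))
  show ?case
  proof (rule Ck_on_Suc_has_derivative[OF assms(1)])
    show "((\<lambda>y. sqrt (F y)) has_derivative
        (\<lambda>v. frechet_derivative F (at y) v * (inverse (sqrt (F y)) * (1/2)))) (at y)"
      if "y \<in> S" for y
      using has_derivative_real_sqrt[OF assms(2)[OF that] Ck_on_Suc_D(1)[OF Suc.prems that]]
      by (simp add: field_simps)
  qed (intro Ck_on_mult Ck_on_const assms inv Ck_on_Suc_D(2)[OF Suc.prems])
qed

lemma Ck_on_norm:
  fixes F :: "'v::euclidean_space \<Rightarrow> 'w::real_inner"
  assumes "open S" "\<And>y. y \<in> S \<Longrightarrow> F y \<noteq> 0" "Ck_on k F S"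
  shows "Ck_on k (\<lambda>y. norm (F y)) S"
  unfolding norm_eq_sqrt_inner
  by (intro Ck_on_sqrt Ck_on_inner assms) (simp add: assms)

subsection \<open>Charts\<close>

lemma smooth_manifold_chart:
  assumes "smooth_manifold X A" "c \<in> A"
  shows "openin X (fst c)" "open (snd c ` fst c)"
    "homeomorphic_map (subtopology X (fst c)) (top_of_set (snd c ` fst c)) (snd c)"
    "inj_on (snd c) (fst c)"
proof -
  show o: "openin X (fst c)" "open (snd c ` fst c)"
    and h: "homeomorphic_map (subtopology X (fst c)) (top_of_set (snd c ` fst c)) (snd c)"
    using assms by (cases c; fastforce simp: smooth_manifold_def)+
  have "topspace (subtopology X (fst c)) = fst c"
    using openin_subset[OF o(1)] by auto
  then show "inj_on (snd c) (fst c)"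
    using homeomorphic_imp_injective_map[OF h] by metis
qed

lemma inv_into_chart_in_topspace:
  assumes "smooth_manifold X A" "c \<in> A" "y \<in> snd c ` fst c"
  shows "inv_into (fst c) (snd c) y \<in> topspace X"
  using inv_into_into[OF assms(3)] openin_subset[OF smooth_manifold_chart(1)[OF assms(1,2)]] by auto

lemma in_chart_eq:
  assumes "smooth_manifold X A" "c \<in> A" "x \<in> fst c"
  shows "in_chart c f (snd c x) = f x"
  using smooth_manifold_chart(4)[OF assms(1,2)] assms(3) by (simp add: in_chart_def)

lemma ex_chart:
  assumes "smooth_manifold X A" "x \<in> topspace X"
  obtains c where "c \<in> A" "x \<in> fst c"
  using assms by (force simp: smooth_manifold_def)

lemma smooth_map_iff:
  "smooth_map A f \<longleftrightarrow> (\<forall>k. \<forall>c\<in>A. Ck_on k (in_chart c f) (snd c ` fst c))"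
  by (force simp: smooth_map_def smooth_on_def)

lemma smooth_map_Ck_on:
  "smooth_map A f \<Longrightarrow> c \<in> A \<Longrightarrow> Ck_on k (in_chart c f) (snd c ` fst c)"
  by (simp add: smooth_map_iff)

lemma smooth_map_has_derivative:
  assumes "smooth_map A f" "c \<in> A" "x \<in> fst c"
  shows "(in_chart c f has_derivative chart_differential c f x) (at (snd c x))"
  unfolding chart_differential_def
  using smooth_map_Ck_on[OF assms(1,2), of "Suc 0"] assms(3) Ck_on_Suc_D(1) by blast

text \<open>The points of a chart domain where the two maps differ form an open set; if it contained
  a point of the closure, it would meet \<open>S\<close>.\<close>

lemma smooth_maps_eq_on_closure:
  assumes M: "smooth_manifold X A" and f: "smooth_map A f" and g: "smooth_map A g"
    and eq: "\<And>x. x \<in> S \<Longrightarrow> f x = g x" and x: "x \<in> X closure_of S"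
  shows "f x = g x"
proof (rule ccontr)
  assume ne: "f x \<noteq> g x"
  have "x \<in> topspace X"
    using x in_closure_of by metis
  then obtain c where c: "c \<in> A" "x \<in> fst c"
    using ex_chart[OF M] by blast
  note ch = smooth_manifold_chart[OF M c(1)]
  have sub: "fst c \<subseteq> topspace X"
    using openin_subset[OF ch(1)] .
  define h where "h y = in_chart c f y - in_chart c g y" for y
  \<comment> \<open>Order 0 suffices, since only continuity of the difference is needed.\<close>
  have "Ck_on 0 h (snd c ` fst c)"
    unfolding h_def by (intro Ck_on_diff smooth_map_Ck_on[OF f c(1)] smooth_map_Ck_on[OF g c(1)] ch)
  then have "open (h -` (- {0}) \<inter> snd c ` fst c)"
    using ch(2) by (simp add: continuous_on_open_vimage open_Compl)
  then have "openin (top_of_set (snd c ` fst c)) (h -` (- {0}) \<inter> snd c ` fst c)"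
    by (simp add: openin_open_eq[OF ch(2)])
  then have "openin (subtopology X (fst c))
      {z \<in> topspace (subtopology X (fst c)). snd c z \<in> h -` (- {0}) \<inter> snd c ` fst c}"
    using homeomorphic_imp_continuous_map[OF ch(3)] openin_continuous_map_preimage by blast
  moreover have "{z \<in> topspace (subtopology X (fst c)). snd c z \<in> h -` (- {0}) \<inter> snd c ` fst c}
      = {z \<in> fst c. f z \<noteq> g z}"
    using sub by (auto simp: h_def in_chart_eq[OF M c(1)] dest: inj_onD[OF ch(4)])
  ultimately have "openin X {z \<in> fst c. f z \<noteq> g z}"
    using openin_trans_full ch(1) by metis
  moreover have "x \<in> {z \<in> fst c. f z \<noteq> g z}"
    using ne c(2) by simp
  moreover have "\<forall>T. x \<in> T \<and> openin X T \<longrightarrow> (\<exists>y. y \<in> S \<and> y \<in> T)"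
    using x in_closure_of by metis
  ultimately obtain z where "z \<in> S" "z \<in> {z \<in> fst c. f z \<noteq> g z}"
    by meson
  then have "z \<in> S" "f z \<noteq> g z"
    by auto
  then show False
    using eq by blast
qed

subsection \<open>The bisecting hyperplane\<close>

text \<open>Used in both directions: a normal \<open>f - g\<close> makes \<open>f - P\<close> normal
  to \<open>g\<close>, which yields the Gauss mapping of \<open>f'\<close>; conversely, for an
  anti-orthotomic \<open>g\<close> it makes \<open>g - f\<close> normal to \<open>f\<close>.\<close>

lemma chart_differential_bisector:
  fixes f g :: "'a \<Rightarrow> real^'m"
  assumes M: "smooth_manifold X A" and f: "smooth_map A f" and g: "smooth_map A g"
    and bis: "\<And>x. x \<in> topspace X \<Longrightarrow> (f x - P) \<bullet> (f x - P) = 2 * ((f x - P) \<bullet> (g x - P))"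
    and c: "c \<in> A" "x \<in> fst c"
  shows "chart_differential c f x v \<bullet> (f x - g x) = (f x - P) \<bullet> chart_differential c g x v"
proof -
  note ch = smooth_manifold_chart[OF M c(1)]
  let ?F = "in_chart c f" and ?G = "in_chart c g" and ?y = "snd c x"
  let ?f = "chart_differential c f x" and ?g = "chart_differential c g x"
  define H where "H y = (?F y - P) \<bullet> (?F y - P) - 2 * ((?F y - P) \<bullet> (?G y - P))" for y
  have "(H has_derivative (\<lambda>v. ((?F ?y - P) \<bullet> ?f v + ?f v \<bullet> (?F ?y - P))
      - 2 * ((?F ?y - P) \<bullet> ?g v + ?f v \<bullet> (?G ?y - P)))) (at ?y)"
    unfolding H_def
    by (auto intro!: derivative_eq_intros smooth_map_has_derivative[OF f c]
        smooth_map_has_derivative[OF g c])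
  \<comment> \<open>\<open>H\<close> vanishes on the whole open chart image, so the derivative
    computed by the product rule must be zero.\<close>
  moreover have "(H has_derivative (\<lambda>_. 0)) (at ?y)"
  proof (rule has_derivative_transform_within_open[OF _ ch(2)])
    show "((\<lambda>_. 0) has_derivative (\<lambda>_. 0)) (at ?y)" by simp
    show "0 = H y" if "y \<in> snd c ` fst c" for y
      using bis[OF inv_into_chart_in_topspace[OF M c(1) that]] by (simp add: H_def in_chart_def)
  qed (use c in auto)
  ultimately have "(\<lambda>v. ((?F ?y - P) \<bullet> ?f v + ?f v \<bullet> (?F ?y - P))
      - 2 * ((?F ?y - P) \<bullet> ?g v + ?f v \<bullet> (?G ?y - P))) = (\<lambda>_. 0)"
    by (rule has_derivative_unique)
  then have "((?F ?y - P) \<bullet> ?f v + ?f v \<bullet> (?F ?y - P))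
      - 2 * ((?F ?y - P) \<bullet> ?g v + ?f v \<bullet> (?G ?y - P)) = 0"
    by meson
  then show ?thesis
    by (simp add: in_chart_eq[OF M c] inner_diff_left inner_diff_right inner_commute)
qed

text \<open>For \<open>d = t *\<^sub>R \<nu>\<close> the last equation is affine in \<open>t\<close>
  with nonzero slope. It is applied with \<open>a = f x - P\<close> and
  \<open>d = g x - f x\<close>.\<close>

lemma normal_line_meets_bisector:
  fixes a \<nu> d :: "'v::real_inner"
  assumes "a \<bullet> \<nu> \<noteq> 0" "d \<in> span {\<nu>}"
    and "a \<bullet> a = 2 * (a \<bullet> (a + d))"
  shows "d = - ((norm a)\<^sup>2 / (2 * (a \<bullet> \<nu>))) *\<^sub>R \<nu>"
proof -
  obtain t where t: "d = t *\<^sub>R \<nu>"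
    using assms(2) by (auto simp: span_singleton)
  have "t = - ((norm a)\<^sup>2 / (2 * (a \<bullet> \<nu>)))"
    using assms(1,3) by (simp add: t inner_add_right field_simps power2_norm_eq_inner)
  then show ?thesis
    using t by simp
qed

text \<open>The image of \<open>L\<close> has codimension one, so its orthogonal complement is a
  line, spanned by any of its nonzero vectors.\<close>

lemma normal_of_hyperplane_in_span:
  fixes L :: "real^'n \<Rightarrow> real^'m"
  assumes dim: "CARD('m) = CARD('n) + 1" and L: "linear L" "inj L"
    and \<nu>: "\<nu> \<noteq> 0" "\<And>v. L v \<bullet> \<nu> = 0" and w: "\<And>v. L v \<bullet> w = 0"
  shows "w \<in> span {\<nu>}"
proof -
  let ?N = "{y. \<forall>x\<in>range L. orthogonal x y}"
  have sub: "subspace (range L)"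
    using L linear_subspace_image subspace_UNIV by blast
  have "dim (range L) = CARD('n)"
    using L by (simp add: dim_image_eq)
  then have "dim ?N = 1"
    using dim_subspace_orthogonal_to_vectors[OF sub subspace_UNIV] dim by simp
  moreover have "{\<nu>} \<subseteq> ?N" "independent {\<nu>}"
    using \<nu> by (auto simp: orthogonal_def)
  ultimately have "?N \<subseteq> span {\<nu>}"
    by (intro card_ge_dim_independent) auto
  then show ?thesis
    using w by (auto simp: orthogonal_def)
qed

text \<open>Since \<open>\<mu> x\<close> is a unit vector, both sides equal
  \<open>4 * ?t\<^sup>2\<close>; this eliminates the Gauss mapping \<open>\<mu>\<close> from the
  defining equation.\<close>

lemma anti_orthotomic_bisector:
  assumes "anti_orthotomic X A f P g \<mu>" "x \<in> topspace X"
  shows "(f x - P) \<bullet> (f x - P) = 2 * ((f x - P) \<bullet> (g x - P))"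
proof -
  let ?t = "(g x - P) \<bullet> \<mu> x"
  have "f x - P = (2 * ?t) *\<^sub>R \<mu> x" "\<mu> x \<bullet> \<mu> x = 1"
    using assms by (auto simp: anti_orthotomic_def frontal_def dot_square_norm)
  then show ?thesis
    by (simp add: inner_commute)
qed

text \<open>\<open>f x - P\<close> is a multiple of the normal \<open>\<mu> x\<close> of
  \<open>g\<close>, so one side of the differentiated bisector equation vanishes.\<close>

lemma anti_orthotomic_normal:
  assumes M: "smooth_manifold X A" and f: "smooth_map A f"
    and g: "anti_orthotomic X A f P g \<mu>" and c: "c \<in> A" "x \<in> fst c"
  shows "chart_differential c f x v \<bullet> (g x - f x) = 0"
proof -
  have x: "x \<in> topspace X"
    using c openin_subset[OF smooth_manifold_chart(1)[OF M c(1)]] by auto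
  have gs: "smooth_map A g"
    using g by (simp add: anti_orthotomic_def frontal_def)
  have "f x - P = (2 * ((g x - P) \<bullet> \<mu> x)) *\<^sub>R \<mu> x" "chart_differential c g x v \<bullet> \<mu> x = 0"
    using g x c by (auto simp: anti_orthotomic_def frontal_def)
  then have "(f x - P) \<bullet> chart_differential c g x v = 0"
    by (simp add: inner_commute)
  then show ?thesis
    using chart_differential_bisector[OF M f gs anti_orthotomic_bisector[OF g] c, of v]
    by (simp add: inner_diff_right)
qed

section \<open>Existence, uniqueness and equidistance of the anti-orthotomic\<close>

theorem theorem1:
  fixes X :: "'a topology" and A :: "('a, 'n::finite) chart set"
    and f \<nu> f' \<nu>' :: "'a \<Rightarrow> real^'m" and P :: "real^'m"
  assumes dim: "CARD('m) = CARD('n) + 1"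
    and manifold: "smooth_manifold X A"
    and frontal: "frontal X A f \<nu>"
    and P: "P \<in> no_silhouette X f \<nu>"
    and f': "\<And>x. x \<in> topspace X \<Longrightarrow>
      f' x = f x - ((norm (f x - P))\<^sup>2 / (2 * ((f x - P) \<bullet> \<nu> x))) *\<^sub>R \<nu> x"
    and \<nu>': "\<And>x. x \<in> topspace X \<Longrightarrow> \<nu>' x = (1 / norm (f x - P)) *\<^sub>R (f x - P)"
  shows "frontal X A f' \<nu>' \<and>
    (anti_orthotomic X A f P f' \<nu>' \<and>
     (\<forall>g \<mu>. anti_orthotomic X A f P g \<mu> \<longrightarrow>
        (\<forall>x\<in>X closure_of regular_points X A f. g x = f' x) \<and>
        (\<forall>x\<in>topspace X. g x - f x \<in> span {\<nu> x} \<longrightarrow> g x = f' x))) \<and>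
    P \<in> no_silhouette X f' \<nu>' \<and>
    (\<forall>x\<in>topspace X. norm (f' x - P) = norm (f' x - f x))"
proof -
  have fs: "smooth_map A f" and \<nu>s: "smooth_map A \<nu>"
    and \<nu>1: "\<And>x. x \<in> topspace X \<Longrightarrow> norm (\<nu> x) = 1"
    and fn: "\<And>x c v. x \<in> topspace X \<Longrightarrow> c \<in> A \<Longrightarrow> x \<in> fst c \<Longrightarrow> chart_differential c f x v \<bullet> \<nu> x = 0"
    using frontal by (auto simp: frontal_def)
  have s: "(f x - P) \<bullet> \<nu> x \<noteq> 0" if "x \<in> topspace X" for x
    using P that by (simp add: no_silhouette_def)
  then have a: "f x - P \<noteq> 0" if "x \<in> topspace X" for x
    using that by fastforce
  have bis: "(f x - P) \<bullet> (f x - P) = 2 * ((f x - P) \<bullet> (f' x - P))" if "x \<in> topspace X" for x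
  proof -
    let ?t = "(norm (f x - P))\<^sup>2 / (2 * ((f x - P) \<bullet> \<nu> x))"
    have "f' x - P = (f x - P) - ?t *\<^sub>R \<nu> x"
      using f'[OF that] by simp
    then have "(f x - P) \<bullet> (f' x - P) = (f x - P) \<bullet> (f x - P) - ?t * ((f x - P) \<bullet> \<nu> x)"
      by (metis inner_diff_right inner_scaleR_right)
    then show ?thesis
      using s[OF that] by (simp add: power2_norm_eq_inner)
  qed
  have f's: "smooth_map A f'"
    unfolding smooth_map_iff
  proof (intro allI ballI)
    fix k c assume c: "c \<in> A"
    let ?S = "snd c ` fst c" and ?F = "in_chart c f" and ?N = "in_chart c \<nu>"
    note S = smooth_manifold_chart(2)[OF manifold c]
    note top = inv_into_chart_in_topspace[OF manifold c]
    \<comment> \<open>With the squared norm written as an inner product, the closure rules apply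
      directly; the no-silhouette condition keeps the denominator away from zero.\<close>
    have *: "Ck_on k (\<lambda>y. ?F y - (((?F y - P) \<bullet> (?F y - P)) /
        (2 * ((?F y - P) \<bullet> ?N y))) *\<^sub>R ?N y) ?S"
      unfolding divide_inverse
      by (intro Ck_on_diff Ck_on_scaleR Ck_on_mult Ck_on_inner Ck_on_inverse Ck_on_const S
          smooth_map_Ck_on[OF fs c] smooth_map_Ck_on[OF \<nu>s c])
        (use s top in \<open>auto simp: in_chart_def\<close>)
    show "Ck_on k (in_chart c f') ?S"
      by (rule Ck_on_cong[OF S _ *])
        (use f' top in \<open>simp add: in_chart_def power2_norm_eq_inner\<close>)
  qed
  have \<nu>'s: "smooth_map A \<nu>'"
    unfolding smooth_map_iff
  proof (intro allI ballI)
    fix k c assume c: "c \<in> A"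
    let ?S = "snd c ` fst c" and ?F = "in_chart c f"
    note S = smooth_manifold_chart(2)[OF manifold c]
    note top = inv_into_chart_in_topspace[OF manifold c]
    have *: "Ck_on k (\<lambda>y. inverse (norm (?F y - P)) *\<^sub>R (?F y - P)) ?S"
      by (intro Ck_on_diff Ck_on_scaleR Ck_on_norm Ck_on_inverse Ck_on_const S
          smooth_map_Ck_on[OF fs c]) (use a top in \<open>auto simp: in_chart_def\<close>)
    show "Ck_on k (in_chart c \<nu>') ?S"
      by (rule Ck_on_cong[OF S _ *])
        (use \<nu>' top in \<open>simp add: in_chart_def inverse_eq_divide\<close>)
  qed
  have "chart_differential c f' x v \<bullet> \<nu>' x = 0"
    if x: "x \<in> topspace X" and c: "c \<in> A" "x \<in> fst c" for x c v
  proof -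
    \<comment> \<open>\<open>f x - f' x\<close> is a multiple of \<open>\<nu> x\<close>, hence
      orthogonal to the image of the differential of \<open>f\<close>.\<close>
    have "(f x - P) \<bullet> chart_differential c f' x v = 0"
      using chart_differential_bisector[OF manifold fs f's bis c, of v] fn[OF x c]
      by (simp add: f'[OF x])
    then show ?thesis
      by (simp add: \<nu>'[OF x] inner_commute)
  qed
  then have fr: "frontal X A f' \<nu>'"
    using f's \<nu>'s \<nu>' a by (simp add: frontal_def)
  \<comment> \<open>Doubling this value and multiplying by \<open>\<nu>' x\<close> returns
    \<open>f x - P\<close>, the anti-orthotomic equation; its being nonzero puts \<open>P\<close> in
    the no-silhouette of \<open>f'\<close>.\<close>
  have prod: "(f' x - P) \<bullet> \<nu>' x = norm (f x - P) / 2" if "x \<in> topspace X" for x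
  proof -
    have "(f' x - P) \<bullet> \<nu>' x = ((f x - P) \<bullet> (f' x - P)) / norm (f x - P)"
      unfolding \<nu>'[OF that] inner_scaleR_right by (simp add: inner_commute)
    also have "(f x - P) \<bullet> (f' x - P) = norm (f x - P) * norm (f x - P) / 2"
      using bis[OF that] by (simp add: dot_square_norm power2_eq_square)
    finally show ?thesis
      using a[OF that] by simp
  qed
  have anti: "anti_orthotomic X A f P f' \<nu>'"
    unfolding anti_orthotomic_def
  proof (intro conjI ballI fr)
    fix x assume x: "x \<in> topspace X"
    show "f x = (2 * ((f' x - P) \<bullet> \<nu>' x)) *\<^sub>R \<nu>' x + P"
      using a[OF x] by (subst prod[OF x]) (simp add: \<nu>'[OF x])
  qed
  have on_normal: "g x = f' x"
    if g: "anti_orthotomic X A f P g \<mu>" and x: "x \<in> topspace X" and gf: "g x - f x \<in> span {\<nu> x}"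
    for g \<mu> x
    using normal_line_meets_bisector[OF s[OF x] gf] anti_orthotomic_bisector[OF g x]
    by (simp add: f'[OF x] algebra_simps)
  have regular: "g x = f' x"
    if g: "anti_orthotomic X A f P g \<mu>" and x: "x \<in> regular_points X A f" for g \<mu> x
  proof -
    obtain c where c: "c \<in> A" "x \<in> fst c" and inj: "inj (chart_differential c f x)"
      and xX: "x \<in> topspace X"
      using x by (auto simp: regular_points_def)
    have "g x - f x \<in> span {\<nu> x}"
    proof (rule normal_of_hyperplane_in_span[OF dim _ inj])
      show "linear (chart_differential c f x)"
        using smooth_map_has_derivative[OF fs c] by (rule has_derivative_linear)
      show "\<nu> x \<noteq> 0"
        using \<nu>1[OF xX] by auto
    qed (use fn xX c anti_orthotomic_normal[OF manifold fs g c] in auto)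
    then show ?thesis
      using on_normal[OF g xX] by simp
  qed
  have "g x = f' x"
    if g: "anti_orthotomic X A f P g \<mu>" and x: "x \<in> X closure_of regular_points X A f" for g \<mu> x
    using smooth_maps_eq_on_closure[OF manifold _ f's regular[OF g] x] g
    by (simp add: anti_orthotomic_def frontal_def)
  moreover have "P \<in> no_silhouette X f' \<nu>'"
    unfolding no_silhouette_def using prod a by fastforce
  \<comment> \<open>Expanding the square of \<open>(f' x - P) - (f x - P)\<close>, the cross term
    cancels the square of \<open>f x - P\<close> by \<open>bis\<close>.\<close>
  moreover have "norm (f' x - P) = norm (f' x - f x)" if "x \<in> topspace X" for x
    using bis[OF that]
    by (simp add: norm_eq_sqrt_inner inner_diff_left inner_diff_right inner_commute)
  ultimately show ?thesis
    using fr anti on_normal by blast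
qed

end
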